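(* For each subset $X$ of $\mathbb{N}$ let $M(X)$ be the monoid defined by the presentation $$\langle a,b,c,d,e \mid ab^ic=ab^id\ (i\in X),\quad ab^jc=ab^je\ (j\in\mathbb{N}\setminus X)\rangle,$$ regarded as a semimetric space via its right Cayley graph with respect to the generating set $\{a,b,c,d,e\}$. Then for any subsets $X$ and $Y$ of $\mathbb{N}$, $M(X)$ and $M(Y)$ are isometric to each other, and to a directed rooted tree in which every vertex has outdegree $4$ or $5$.
   Context: $\mathbb{N}$ includes $0$. For a monoid $M$ generated by a finite set $S$, the right Cayley graph is the directed graph with vertex set $M$ and a (single) edge from $x$ to $y$ if and only if $xs=y$ for some $s\in S$. A directed graph is regarded as a semimetric space on its vertex set, with $d(x,y)$ the length of a shortest directed path from $x$ to $y$, or $\infty$ if there is none. An isometry between semimetric spaces is a surjective map $f$ with $d(f(x),f(y))=d(x,y)$ for all $x,y$. A directed rooted tree is a tree with a distinguished root vertex in which all edges are directed away from the root. *)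

theory Defs
  imports
    "HOL-Algebra.Group"
    "Graph_Theory.Graph_Theory"
begin

section \<open>Monoid presentations\<close>

text \<open>Words over the alphabet \<open>'a\<close> are lists; the free monoid is \<open>'a list\<close> under append.\<close>

inductive_set presentation_cong :: "('a list \<times> 'a list) set \<Rightarrow> ('a list \<times> 'a list) set"
  for R :: "('a list \<times> 'a list) set"
  where
    base: "(u, v) \<in> R \<Longrightarrow> (u, v) \<in> presentation_cong R"
  | refl: "(u, u) \<in> presentation_cong R"
  | sym: "(u, v) \<in> presentation_cong R \<Longrightarrow> (v, u) \<in> presentation_cong R"
  | trans: "(u, v) \<in> presentation_cong R \<Longrightarrow> (v, w) \<in> presentation_cong R
            \<Longrightarrow> (u, w) \<in> presentation_cong R"
  | append: "(u, v) \<in> presentation_cong R \<Longrightarrow> (u', v') \<in> presentation_cong R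
            \<Longrightarrow> (u @ u', v @ v') \<in> presentation_cong R"

definition presented_monoid :: "('a list \<times> 'a list) set \<Rightarrow> 'a list set monoid" where
  "presented_monoid R =
    \<lparr> carrier = UNIV // presentation_cong R,
      monoid.mult = (\<lambda>P Q. \<Union>u\<in>P. \<Union>v\<in>Q. presentation_cong R `` {u @ v}),
      one = presentation_cong R `` {[]} \<rparr>"

definition presented_gens :: "('a list \<times> 'a list) set \<Rightarrow> 'a list set set" where
  "presented_gens R = range (\<lambda>x. presentation_cong R `` {[x]})"

lemma equiv_presentation_cong: "equiv UNIV (presentation_cong R)"
proof (rule equivI)
  show "refl (presentation_cong R)"
    by (rule refl_onI) (rule presentation_cong.refl)
  show "sym (presentation_cong R)"
    by (rule symI) (rule presentation_cong.sym)
  show "trans (presentation_cong R)"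
    by (rule transI) (rule presentation_cong.trans)
qed simp

lemma presented_mult_class:
  "presentation_cong R `` {u} \<otimes>\<^bsub>presented_monoid R\<^esub> presentation_cong R `` {v}
    = presentation_cong R `` {u @ v}"
proof -
  let ?C = "\<lambda>w. presentation_cong R `` {w}"
  have *: "?C (u' @ v') = ?C (u @ v)" if "u' \<in> ?C u" "v' \<in> ?C v" for u' v'
    using equiv_class_eq[OF equiv_presentation_cong presentation_cong.append[of u u' R v v']] that
    by simp
  have **: "u \<in> ?C u" "v \<in> ?C v"
    by (simp_all add: presentation_cong.refl)
  have "(\<Union>u'\<in>?C u. \<Union>v'\<in>?C v. ?C (u' @ v')) = (\<Union>u'\<in>?C u. \<Union>v'\<in>?C v. ?C (u @ v))"
    using * by (intro SUP_cong HOL.refl)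
  also have "\<dots> = ?C (u @ v)"
    using ** by blast
  finally show ?thesis
    by (simp add: presented_monoid_def)
qed

lemma monoid_presented_monoid: "monoid (presented_monoid R)"
proof -
  let ?C = "\<lambda>w. presentation_cong R `` {w}"
  have carrier: "carrier (presented_monoid R) = range ?C"
    by (auto simp: presented_monoid_def quotient_def)
  have one: "\<one>\<^bsub>presented_monoid R\<^esub> = ?C []"
    by (simp add: presented_monoid_def)
  show ?thesis
  proof
    fix x y z
    assume "x \<in> carrier (presented_monoid R)" "y \<in> carrier (presented_monoid R)"
      "z \<in> carrier (presented_monoid R)"
    then obtain u v w where [simp]: "x = ?C u" "y = ?C v" "z = ?C w"
      unfolding carrier by blast
    show "x \<otimes>\<^bsub>presented_monoid R\<^esub> y \<in> carrier (presented_monoid R)"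
      "x \<otimes>\<^bsub>presented_monoid R\<^esub> y \<otimes>\<^bsub>presented_monoid R\<^esub> z
        = x \<otimes>\<^bsub>presented_monoid R\<^esub> (y \<otimes>\<^bsub>presented_monoid R\<^esub> z)"
      "\<one>\<^bsub>presented_monoid R\<^esub> \<otimes>\<^bsub>presented_monoid R\<^esub> x = x"
      "x \<otimes>\<^bsub>presented_monoid R\<^esub> \<one>\<^bsub>presented_monoid R\<^esub> = x"
      unfolding carrier one by (simp_all add: presented_mult_class)
  qed (auto simp: carrier one)
qed


section \<open>Digraphs as semimetric spaces\<close>

text \<open>
  \<open>wf_digraph.\<mu>\<close> is the infimum of the weights of the directed walks between two vertices. With
  unit weights this is the length of a shortest path, and \<open>\<infinity>\<close> (the empty infimum) if there is none.
\<close>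

definition digraph_dist :: "('a, 'b) pre_digraph \<Rightarrow> 'a \<Rightarrow> 'a \<Rightarrow> ereal" where
  "digraph_dist G u v = wf_digraph.\<mu> G (\<lambda>_. 1) u v"

definition isometry ::
  "'a set \<Rightarrow> ('a \<Rightarrow> 'a \<Rightarrow> ereal) \<Rightarrow> 'b set \<Rightarrow> ('b \<Rightarrow> 'b \<Rightarrow> ereal) \<Rightarrow> ('a \<Rightarrow> 'b) \<Rightarrow> bool" where
  "isometry V d W d' f \<longleftrightarrow> f ` V = W \<and> (\<forall>x\<in>V. \<forall>y\<in>V. d' (f x) (f y) = d x y)"

definition isometric :: "('a, 'b) pre_digraph \<Rightarrow> ('c, 'd) pre_digraph \<Rightarrow> bool" where
  "isometric G H \<longleftrightarrow>
    (\<exists>f. isometry (verts G) (digraph_dist G) (verts H) (digraph_dist H) f)"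

definition right_cayley_graph :: "('a, 'm) monoid_scheme \<Rightarrow> 'a set \<Rightarrow> 'a pair_pre_digraph" where
  "right_cayley_graph M S =
    \<lparr> pverts = carrier M,
      parcs = {(x, y). x \<in> carrier M \<and> y \<in> carrier M \<and> (\<exists>s\<in>S. x \<otimes>\<^bsub>M\<^esub> s = y)} \<rparr>"

lemma pair_wf_digraph_right_cayley_graph: "pair_wf_digraph (right_cayley_graph M S)"
  by unfold_locales (auto simp: right_cayley_graph_def)


section \<open>Directed rooted trees\<close>

text \<open>
  The library's \<open>tree\<close> only excludes directed cycles, so it is not used here: a tree must not have
  cycles in its underlying undirected graph. In \<open>mk_symmetric G\<close> every undirected edge becomes
  a pair of opposite arcs, so closed walks of length 2 there are not cycles of the undirected graph.
\<close>

definition underlying_tree :: "('a, 'b) pre_digraph \<Rightarrow> bool" where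
  "underlying_tree G \<longleftrightarrow>
    connected G \<and> \<not> (\<exists>p. pre_digraph.cycle (mk_symmetric G) p \<and> length p \<noteq> 2)"

text \<open>
  An arc is directed away from the root if its head is one step further from the root than its
  tail in the underlying undirected tree. This also excludes pairs of opposite arcs.
\<close>

definition directed_rooted_tree :: "'a pair_pre_digraph \<Rightarrow> 'a \<Rightarrow> bool" where
  "directed_rooted_tree T r \<longleftrightarrow>
    pair_wf_digraph T \<and> underlying_tree T \<and> r \<in> pverts T \<and>
    (\<forall>(u, v) \<in> parcs T.
      digraph_dist (mk_symmetric T) r v = digraph_dist (mk_symmetric T) r u + 1)"


section \<open>The monoids \<open>M(X)\<close>\<close>

datatype letter = La | Lb | Lc | Ld | Le

definition M_rels :: "nat set \<Rightarrow> (letter list \<times> letter list) set" where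
  "M_rels X =
    {([La] @ replicate i Lb @ [Lc], [La] @ replicate i Lb @ [Ld]) | i. i \<in> X} \<union>
    {([La] @ replicate j Lb @ [Lc], [La] @ replicate j Lb @ [Le]) | j. j \<notin> X}"

definition M_monoid :: "nat set \<Rightarrow> letter list set monoid" where
  "M_monoid X = presented_monoid (M_rels X)"

definition M_graph :: "nat set \<Rightarrow> letter list set pair_pre_digraph" where
  "M_graph X = right_cayley_graph (M_monoid X) (presented_gens (M_rels X))"

end

theory Submission
  imports Defs
begin

text \<open>
  All relations of \<open>M(X)\<close> rewrite the last letter of a word \<open>a b\<^sup>i x\<close>. Hence the class of a word
  can be read off letter by letter: after a prefix ending in \<open>a b\<^sup>i\<close>, exactly two of the letters
  \<open>c, d, e\<close> get identified. Which two depends on \<open>X\<close>, but renaming the two remaining classes to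
  \<open>c\<close> and \<open>e\<close> gives a bijection of \<open>M(X)\<close> onto the words in which no \<open>d\<close> directly follows
  an \<open>a b\<^sup>i\<close>, independently of \<open>X\<close>. Under it the Cayley graph becomes the prefix tree of these words.
\<close>

section \<open>Isomorphisms and distances\<close>

lemma pair_awalk_iff:
  "pre_digraph.awalk (with_proj G) u p v \<longleftrightarrow> u \<in> pverts G \<and> set p \<subseteq> parcs G \<and> pcas u p v"
  by (simp add: pre_digraph.awalk_def cas_with_proj_eq)

lemma digraph_dist_eq_INF:
  assumes "pair_wf_digraph G"
  shows "digraph_dist (with_proj G) u v =
    (INF p\<in>{p. pre_digraph.awalk (with_proj G) u p v}. ereal (length p))"
proof -
  interpret pair_wf_digraph G by fact
  have "awalk_cost (\<lambda>_. 1) p = length p" for p :: "('a \<times> 'a) list"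
    by (induction p) auto
  then show ?thesis by (simp add: digraph_dist_def \<mu>_def)
qed

definition graph_iso :: "'a pair_pre_digraph \<Rightarrow> 'b pair_pre_digraph \<Rightarrow> ('a \<Rightarrow> 'b) \<Rightarrow> bool" where
  "graph_iso G H f \<longleftrightarrow> bij_betw f (pverts G) (pverts H) \<and>
    (\<forall>x\<in>pverts G. \<forall>y\<in>pverts G. (x, y) \<in> parcs G \<longleftrightarrow> (f x, f y) \<in> parcs H)"

lemma graph_iso_inv:
  assumes "graph_iso G H f"
  shows "graph_iso H G (the_inv_into (pverts G) f)"
proof -
  let ?g = "the_inv_into (pverts G) f"
  have f: "bij_betw f (pverts G) (pverts H)" using assms by (simp add: graph_iso_def)
  then have g: "bij_betw ?g (pverts H) (pverts G)" by (rule bij_betw_the_inv_into)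
  have "(x, y) \<in> parcs H \<longleftrightarrow> (?g x, ?g y) \<in> parcs G" if "x \<in> pverts H" "y \<in> pverts H" for x y
  proof -
    have "?g x \<in> pverts G" "?g y \<in> pverts G"
      using that by (auto intro: bij_betw_apply[OF g])
    moreover have "f (?g x) = x" "f (?g y) = y"
      using that by (auto intro: f_the_inv_into_f_bij_betw[OF f])
    ultimately show ?thesis using assms by (simp add: graph_iso_def)
  qed
  with g show ?thesis by (simp add: graph_iso_def)
qed

lemma graph_iso_comp:
  assumes "graph_iso G H f" "graph_iso H K g"
  shows "graph_iso G K (g \<circ> f)"
proof -
  have "f x \<in> pverts H" if "x \<in> pverts G" for x
    using assms(1) that by (auto simp: graph_iso_def dest: bij_betw_apply)
  then show ?thesis
    using assms unfolding graph_iso_def by (auto intro: bij_betw_trans)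
qed

text \<open>A homomorphism carries walks to walks of the same length. Infinite distances need no
  separate case, since an empty infimum is bounded below by everything.\<close>

lemma digraph_dist_image_le:
  assumes G: "pair_wf_digraph G" and H: "pair_wf_digraph H"
    and verts: "f ` pverts G \<subseteq> pverts H"
    and arcs: "\<And>x y. (x, y) \<in> parcs G \<Longrightarrow> (f x, f y) \<in> parcs H"
  shows "digraph_dist (with_proj H) (f u) (f v) \<le> digraph_dist (with_proj G) u v"
proof -
  have "pcas (f u) (map (map_prod f f) p) (f v)" if "pcas u p v" for u p
    using that by (induction p arbitrary: u) auto
  then have *: "pre_digraph.awalk (with_proj H) (f u) (map (map_prod f f) p) (f v)"
    if "pre_digraph.awalk (with_proj G) u p v" for p
    using that verts arcs by (auto simp: pair_awalk_iff)
  show ?thesis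
    unfolding digraph_dist_eq_INF[OF G] digraph_dist_eq_INF[OF H]
  proof (rule INF_greatest)
    fix p assume "p \<in> {p. pre_digraph.awalk (with_proj G) u p v}"
    then show "(INF p\<in>{p. pre_digraph.awalk (with_proj H) (f u) p (f v)}. ereal (length p))
        \<le> ereal (length p)"
      using * by (intro INF_lower2[of "map (map_prod f f) p"]) auto
  qed
qed

lemma isometricI:
  assumes "isometry (verts G) (digraph_dist G) (verts H) (digraph_dist H) f"
  shows "isometric G H"
  by (simp only: isometric_def) (rule exI, rule assms)

lemma digraph_dist_graph_iso_le:
  assumes "pair_wf_digraph G" "pair_wf_digraph H" "graph_iso G H f"
  shows "digraph_dist (with_proj H) (f x) (f y) \<le> digraph_dist (with_proj G) x y"
proof (rule digraph_dist_image_le)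
  show "f ` pverts G \<subseteq> pverts H"
    using assms(3) by (simp add: graph_iso_def bij_betw_def)
  show "(f x, f y) \<in> parcs H" if "(x, y) \<in> parcs G" for x y
    using that assms(3) pair_wf_digraph.wellformed'[OF assms(1) that]
    by (simp add: graph_iso_def)
qed (rule assms)+

lemma isometric_if_graph_iso:
  assumes G: "pair_wf_digraph G" and H: "pair_wf_digraph H" and iso: "graph_iso G H f"
  shows "isometric (with_proj G) (with_proj H)"
proof (rule isometricI)
  let ?f' = "the_inv_into (pverts G) f"
  have "digraph_dist (with_proj H) (f x) (f y) = digraph_dist (with_proj G) x y"
    if "x \<in> pverts G" "y \<in> pverts G" for x y
  proof (rule antisym)
    have "?f' (f x) = x" "?f' (f y) = y"
      using iso that by (simp_all add: graph_iso_def bij_betw_def the_inv_into_f_f)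
    \<comment> \<open>The reverse inequality is the same estimate for the inverse
      isomorphism.\<close>
    then show "digraph_dist (with_proj G) x y \<le> digraph_dist (with_proj H) (f x) (f y)"
      using digraph_dist_graph_iso_le[OF H G graph_iso_inv[OF iso], of "f x" "f y"] by simp
  qed (rule digraph_dist_graph_iso_le[OF G H iso])
  moreover have "f ` pverts G = pverts H"
    using iso by (simp add: graph_iso_def bij_betw_def)
  ultimately show "isometry (verts (with_proj G)) (digraph_dist (with_proj G))
      (verts (with_proj H)) (digraph_dist (with_proj H)) f"
    unfolding isometry_def with_proj_simps by (intro conjI ballI)
qed

section \<open>Recognising directed rooted trees\<close>

text \<open>
  A cycle of the underlying graph has a vertex of maximal height; both its neighbours on the cycle
  are parents of it, so they coincide and the cycle has length 2.
\<close>

lemma graded_cycle_length: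
  fixes h :: "'a \<Rightarrow> nat"
  assumes step: "\<And>u v. (u, v) \<in> A \<Longrightarrow> h v = Suc (h u)"
    and unique: "\<And>u u' v. (u, v) \<in> A \<Longrightarrow> (u', v) \<in> A \<Longrightarrow> u = u'"
    and p: "set p \<subseteq> A \<union> A\<inverse>" "p \<noteq> []" "distinct (map snd p)"
    and chain: "\<And>k. k < length p \<Longrightarrow> fst (p ! (Suc k mod length p)) = snd (p ! k)"
  shows "length p = 2"
proof -
  let ?n = "length p"
  have n: "?n > 0" using p by simp
  have arc: "p ! k \<in> A \<union> A\<inverse>" if "k < ?n" for k
    using p that by (meson nth_mem subsetD)
  have not_loop: "fst (p ! k) \<noteq> snd (p ! k)" if "k < ?n" for k
    using arc[OF that] by (cases "p ! k") (auto dest: step)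
  have "Max ((\<lambda>k. h (snd (p ! k))) ` {..<?n}) \<in> (\<lambda>k. h (snd (p ! k))) ` {..<?n}"
    using n by (intro Max_in) auto
  then obtain k where k: "k < ?n" "\<And>j. j < ?n \<Longrightarrow> h (snd (p ! j)) \<le> h (snd (p ! k))"
    by (smt (verit) Max_ge finite_imageI finite_lessThan imageE imageI lessThan_iff)
  let ?prev = "(k + (?n - 1)) mod ?n" and ?next = "Suc k mod ?n"
  have less: "?prev < ?n" "?next < ?n" using n by auto
  have "Suc ?prev mod ?n = k"
    using k n by (simp add: mod_Suc_eq)
  then have prev: "snd (p ! ?prev) = fst (p ! k)"
    using chain[OF less(1)] by simp
  have into: "(fst (p ! k), snd (p ! k)) \<in> A"
    using arc[OF k(1)] k(2)[OF less(1)] prev by (cases "p ! k") (auto dest: step)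
  have "(snd (p ! ?next), snd (p ! k)) \<in> A"
    using arc[OF less(2)] k(2)[OF less(2)] chain[OF k(1)]
    by (cases "p ! ?next") (auto dest: step)
  then have "snd (p ! ?next) = snd (p ! ?prev)"
    using unique into prev by metis
  \<comment> \<open>The heads on the cycle are distinct, so equal vertices sit at equal
    positions.\<close>
  then have eq: "?next = ?prev"
    using p(3) less by (simp add: distinct_conv_nth) metis
  have "?n \<noteq> 1"
  proof
    assume "?n = 1"
    then show False using chain[of 0] not_loop[of 0] by simp
  qed
  show ?thesis
  proof (rule ccontr)
    assume "?n \<noteq> 2"
    then have n3: "?n \<ge> 3" using n \<open>?n \<noteq> 1\<close> by linarith
    have prev_eq: "?prev = k - 1" if "k > 0"
    proof -
      have "k + (?n - 1) = (k - 1) + ?n" using that n by linarith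
      then have "?prev = ((k - 1) + ?n) mod ?n" by (rule arg_cong)
      also have "\<dots> = (k - 1) mod ?n" by (rule mod_add_self2)
      also have "\<dots> = k - 1" using k(1) by (intro mod_less) linarith
      finally show ?thesis .
    qed
    \<comment> \<open>The cases separate the two wrap-arounds from the interior; in each,
      \<open>?next\<close> and \<open>?prev\<close> differ once \<open>?n \<ge> 3\<close>.\<close>
    consider "k = 0" | "k > 0" "Suc k < ?n" | "k > 0" "Suc k = ?n" using k by linarith
    then show False
    proof cases
      case 1
      then have "?next = 1" "?prev = ?n - 1" using n3 by simp_all
      then show ?thesis using eq n3 by linarith
    next
      case 2
      then have "?next = Suc k" by simp
      then show ?thesis using eq prev_eq[OF 2(1)] by linarith
    next
      case 3
      then have "?next = 0" by simp
      then show ?thesis using eq prev_eq[OF 3(1)] 3 n3 by linarith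
    qed
  qed
qed

lemma pcas_nth_Suc: "pcas u p v \<Longrightarrow> Suc k < length p \<Longrightarrow> fst (p ! Suc k) = snd (p ! k)"
proof (induction p arbitrary: u k)
  case (Cons e p)
  then show ?case by (cases k; cases p) auto
qed simp

lemma pcas_last: "pcas u p v \<Longrightarrow> p \<noteq> [] \<Longrightarrow> snd (last p) = v"
  by (induction p arbitrary: u) auto

lemma tl_pawalk_verts: "pcas u p v \<Longrightarrow> tl (pawalk_verts u p) = map snd p"
proof -
  have "pcas u p v \<Longrightarrow> pawalk_verts u p = u # map snd p" for u
    by (induction p arbitrary: u) auto
  then show "pcas u p v \<Longrightarrow> tl (pawalk_verts u p) = map snd p" by simp
qed

text \<open>Following parents from \<open>v\<close> reaches the root in \<open>h v\<close> steps,
  and no undirected walk is shorter because each step changes \<open>h\<close> by one. So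
  \<open>h\<close> is the undirected distance from the root, and \<open>graded_cycle_length\<close>
  excludes cycles.\<close>

lemma directed_rooted_treeI:
  fixes T :: "'a pair_pre_digraph" and h :: "'a \<Rightarrow> nat"
  assumes wf: "pair_wf_digraph T" and root: "r \<in> pverts T" "h r = 0"
    and step: "\<And>u v. (u, v) \<in> parcs T \<Longrightarrow> h v = Suc (h u)"
    and unique: "\<And>u u' v. (u, v) \<in> parcs T \<Longrightarrow> (u', v) \<in> parcs T \<Longrightarrow> u = u'"
    and parent: "\<And>v. v \<in> pverts T \<Longrightarrow> v \<noteq> r \<Longrightarrow> \<exists>u. (u, v) \<in> parcs T"
  shows "directed_rooted_tree T r"
proof -
  interpret T: pair_wf_digraph T by fact
  let ?S = "mk_symmetric (with_proj T)"
  have parcs_S: "parcs ?S = parcs T \<union> (parcs T)\<inverse>"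
    by (auto simp: parcs_mk_symmetric)
  interpret S: pair_wf_digraph ?S by (rule T.wellformed_mk_symmetric)

  have path: "\<exists>p. S.awalk r p v \<and> length p = h v" if "v \<in> pverts T" for v
    using that
  proof (induction "h v" arbitrary: v)
    case 0
    then have "v = r" using parent step by (metis nat.distinct(1))
    then show ?case using root by (auto simp: S.awalk_Nil_iff intro!: exI[of _ "[]"])
  next
    case (Suc n)
    then obtain u where u: "(u, v) \<in> parcs T"
      using parent root by (metis nat.distinct(1))
    then obtain p where "S.awalk r p u" "length p = h u"
      using Suc step[OF u] T.in_arcsD1[OF u] by auto
    moreover have "S.awalk u [(u, v)] v"
      using u T.wellformed'[OF u] by (simp add: S.awalk_def parcs_S)
    ultimately have "S.awalk r (p @ [(u, v)]) v" "length (p @ [(u, v)]) = h v"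
      using step[OF u] by (auto intro: S.awalk_appendI)
    then show ?case by blast
  qed

  have lower: "h v \<le> h u + length p" if "S.awalk u p v" for u p v
  proof -
    have "pcas u p v" "set p \<subseteq> parcs ?S" using that by (simp_all add: pair_awalk_iff)
    then show ?thesis
      by (induction p arbitrary: u) (force simp: parcs_S dest: step)+
  qed

  have dist: "digraph_dist ?S r v = ereal (h v)" if "v \<in> pverts T" for v
    unfolding digraph_dist_eq_INF[OF S.pair_wf_digraph_axioms]
  proof (rule antisym)
    show "(INF p\<in>{p. S.awalk r p v}. ereal (length p)) \<le> ereal (h v)"
      using path[OF that] by (auto intro: INF_lower2)
    show "ereal (h v) \<le> (INF p\<in>{p. S.awalk r p v}. ereal (length p))"
      using lower[of r _ v] root by (intro INF_greatest) auto
  qed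

  have "length p = 2" if cycle: "S.cycle p" for p
  proof -
    obtain u where u: "S.awalk u p u" "distinct (tl (S.awalk_verts u p))" "p \<noteq> []"
      using cycle by (auto simp: S.cycle_def)
    then have cas: "pcas u p u" and sub: "set p \<subseteq> parcs ?S"
      by (simp_all add: pair_awalk_iff)
    have "fst (p ! (Suc k mod length p)) = snd (p ! k)" if "k < length p" for k
    proof (cases "Suc k < length p")
      case True
      then show ?thesis using pcas_nth_Suc[OF cas] by simp
    next
      \<comment> \<open>At the last position the index wraps to the first arc, and the walk is
        closed at \<open>u\<close>.\<close>
      case False
      then have k: "Suc k = length p" using that by simp
      then have "p ! k = last p" using u(3) by (simp add: last_conv_nth flip: k)
      moreover have "fst (p ! 0) = u" using cas u(3) by (cases p) auto
      ultimately show ?thesis using pcas_last[OF cas u(3)] k by simp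
    qed
    moreover have "distinct (map snd p)"
      using u(2) tl_pawalk_verts[OF cas] by simp
    ultimately show ?thesis
      using graded_cycle_length[of "parcs T" h p] step unique sub u(3) unfolding parcs_S by blast
  qed
  then have acyclic: "\<not> (\<exists>p. S.cycle p \<and> length p \<noteq> 2)" by blast

  have "r \<rightarrow>\<^sup>*\<^bsub>with_proj ?S\<^esub> v" if "v \<in> pverts T" for v
    using path[OF that] by (auto simp: S.reachable_awalk)
  moreover from this have "v \<rightarrow>\<^sup>*\<^bsub>with_proj ?S\<^esub> r" if "v \<in> pverts T" for v
    using that symmetric_mk_symmetric by (metis symmetric_reachable S.wf_digraph_axioms)
  ultimately have "connected (with_proj T)"
    unfolding connected_def strongly_connected_def
    using root(1) by (auto intro: S.reachable_trans)
  then show ?thesis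
    using wf acyclic root(1) dist T.wellformed' step
    by (auto simp: directed_rooted_tree_def underlying_tree_def)
qed

section \<open>Relabelling words\<close>

text \<open>The state \<open>Some i\<close> means that the word read so far ends in \<open>a b\<^sup>i\<close>.\<close>

fun scan :: "nat option \<Rightarrow> letter \<Rightarrow> nat option" where
  "scan s La = Some 0"
| "scan s Lb = map_option Suc s"
| "scan s _ = None"

definition state :: "letter list \<Rightarrow> nat option" where
  "state w = foldl scan None w"

text \<open>In state \<open>Some i\<close>, \<open>Lc\<close> represents the pair of identified
  letters and \<open>Le\<close> the remaining one of \<open>Lc\<close>, \<open>Ld\<close>,
  \<open>Le\<close>.\<close>

fun merge :: "nat set \<Rightarrow> nat option \<Rightarrow> letter \<Rightarrow> letter" where
  "merge X (Some i) Ld = (if i \<in> X then Lc else Le)"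
| "merge X (Some i) Le = (if i \<in> X then Le else Lc)"
| "merge X s x = x"

fun relabel_from :: "nat set \<Rightarrow> nat option \<Rightarrow> letter list \<Rightarrow> letter list" where
  "relabel_from X s [] = []"
| "relabel_from X s (x # w) = merge X s x # relabel_from X (scan s x) w"

abbreviation relabel :: "nat set \<Rightarrow> letter list \<Rightarrow> letter list" where
  "relabel X \<equiv> relabel_from X None"

definition allowed :: "nat option \<Rightarrow> letter set" where
  "allowed s = (if s = None then UNIV else UNIV - {Ld})"

fun tree_from :: "nat option \<Rightarrow> letter list \<Rightarrow> bool" where
  "tree_from s [] \<longleftrightarrow> True"
| "tree_from s (x # w) \<longleftrightarrow> x \<in> allowed s \<and> tree_from (scan s x) w"

definition tree_words :: "letter list set" where
  "tree_words = {w. tree_from None w}"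

lemma UNIV_letter: "UNIV = {La, Lb, Lc, Ld, Le}"
  using letter.exhaust by auto

lemma state_Nil [simp]: "state [] = None"
  by (simp add: state_def)

lemma state_snoc [simp]: "state (w @ [x]) = scan (state w) x"
  by (simp add: state_def)

text \<open>Only letters that reset the state are changed, and they become letters that reset it
  too. Hence a relabelled word determines the states of the original.\<close>

lemma scan_merge [simp]: "scan s (merge X s x) = scan s x"
  by (cases s; cases x) auto

lemma foldl_scan_relabel_from: "foldl scan s (relabel_from X s w) = foldl scan s w"
  by (induction w arbitrary: s) auto

lemma state_relabel: "state (relabel X w) = state w"
  by (simp add: state_def foldl_scan_relabel_from)

lemma relabel_from_append:
  "relabel_from X s (u @ v) = relabel_from X s u @ relabel_from X (foldl scan s u) v"
  by (induction u arbitrary: s) auto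

lemma relabel_snoc: "relabel X (w @ [x]) = relabel X w @ [merge X (state w) x]"
  by (simp add: relabel_from_append state_def)

lemma tree_from_append:
  "tree_from s (u @ v) \<longleftrightarrow> tree_from s u \<and> tree_from (foldl scan s u) v"
  by (induction u arbitrary: s) auto

lemma Nil_in_tree_words: "[] \<in> tree_words"
  by (simp add: tree_words_def)

lemma snoc_in_tree_words:
  "w @ [x] \<in> tree_words \<longleftrightarrow> w \<in> tree_words \<and> x \<in> allowed (state w)"
  by (auto simp: tree_words_def tree_from_append state_def)

text \<open>This is where the dependence on \<open>X\<close> disappears: \<open>X\<close> affects
  which letters are merged, but not the set of images.\<close>

lemma range_merge: "range (merge X s) = allowed s"
  by (cases s) (auto simp: UNIV_letter allowed_def)

lemma range_relabel: "range (relabel X) = tree_words"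
proof (rule Set.set_eqI)
  show "w \<in> range (relabel X) \<longleftrightarrow> w \<in> tree_words" for w
  proof (induction w rule: rev_induct)
    case Nil
    then show ?case by (auto simp: Nil_in_tree_words intro!: image_eqI[of _ _ "[]"])
  next
    case (snoc x w)
    have "w @ [x] \<in> range (relabel X) \<longleftrightarrow>
        (\<exists>u y. w = relabel X u \<and> x = merge X (state u) y)" (is "?L \<longleftrightarrow> ?R")
    proof
      assume ?L
      then obtain v where v: "relabel X v = w @ [x]" by auto
      then have "v \<noteq> []" by auto
      then obtain u y where "v = u @ [y]" by (metis rev_exhaust)
      then show ?R using v by (auto simp: relabel_snoc)
    next
      assume ?R
      then obtain u y where "w = relabel X u" "x = merge X (state u) y" by blast
      then have "w @ [x] = relabel X (u @ [y])" by (simp add: relabel_snoc)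
      then show ?L by blast
    qed
    \<comment> \<open>The state is visible in the image \<open>w\<close>, so the conditions on
      \<open>u\<close> and \<open>y\<close> decouple.\<close>
    also have "\<dots> \<longleftrightarrow> (\<exists>u y. w = relabel X u \<and> x = merge X (state w) y)"
      by (metis state_relabel)
    also have "\<dots> \<longleftrightarrow> w \<in> range (relabel X) \<and> x \<in> range (merge X (state w))"
      by blast
    finally show ?case
      by (simp add: snoc range_merge snoc_in_tree_words)
  qed
qed

section \<open>The word problem of \<open>M(X)\<close>\<close>

lemma foldl_scan_replicate_Lb: "foldl scan (Some i) (replicate n Lb) = Some (i + n)"
  by (induction n arbitrary: i) auto

text \<open>Supplies the suffix on which a defining relation can act.\<close>

lemma state_eq_SomeD: "state w = Some i \<Longrightarrow> \<exists>t. w = t @ [La] @ replicate i Lb"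
proof (induction w arbitrary: i rule: rev_induct)
  case (snoc x w)
  then show ?case
  proof (cases x)
    case Lb
    then obtain j where j: "i = Suc j" "state w = Some j" using snoc.prems by auto
    with snoc.IH obtain t where "w = t @ [La] @ replicate j Lb" by blast
    then show ?thesis using j Lb by (auto simp: replicate_append_same)
  qed auto
qed simp

text \<open>Soundness of relabelling. The start state is arbitrary and the final states are compared
  because, in a concatenation, the second factor is read from the state left by the first.\<close>

lemma relabel_from_cong:
  assumes "(u, v) \<in> presentation_cong (M_rels X)"
  shows "relabel_from X s u = relabel_from X s v \<and> foldl scan s u = foldl scan s v"
  using assms
proof (induction arbitrary: s)
  case (base u v)
  then show ?case
    by (auto simp: M_rels_def relabel_from_append foldl_scan_replicate_Lb)
next
  case (append u v u' v')
  then show ?case by (metis relabel_from_append foldl_append)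
qed auto

lemma cong_if_merge_eq:
  assumes "merge X (state w) x = merge X (state w) y"
  shows "(w @ [x], w @ [y]) \<in> presentation_cong (M_rels X)"
proof (cases "x = y")
  case True
  then show ?thesis by (simp add: presentation_cong.refl)
next
  case False
  with assms obtain i where i: "state w = Some i" by (cases "state w") auto
  let ?P = "presentation_cong (M_rels X)"
  \<comment> \<open>The letter that the relation with index \<open>i\<close> equates with
    \<open>Lc\<close>.\<close>
  let ?z = "if i \<in> X then Ld else Le"
  obtain t where t: "w = t @ [La] @ replicate i Lb" using state_eq_SomeD[OF i] by blast
  have "([La] @ replicate i Lb @ [Lc], [La] @ replicate i Lb @ [?z]) \<in> ?P"
    by (rule presentation_cong.base) (auto simp: M_rels_def)
  then have "(w @ [Lc], w @ [?z]) \<in> ?P"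
    using presentation_cong.append[OF presentation_cong.refl[of t]] by (simp add: t)
  moreover from this have "(w @ [?z], w @ [Lc]) \<in> ?P" by (rule presentation_cong.sym)
  moreover have "x = Lc \<and> y = ?z \<or> x = ?z \<and> y = Lc"
    using assms False i by (cases x; cases y) (auto split: if_splits)
  ultimately show ?thesis by blast
qed

text \<open>Completeness, by induction on the last letter: first exchange the last letter after the
  prefix \<open>u\<close>, which is possible because both prefixes have the same state, then
  exchange the prefix.\<close>

lemma cong_if_relabel_eq:
  assumes "relabel X u = relabel X v"
  shows "(u, v) \<in> presentation_cong (M_rels X)"
  using assms
proof (induction u arbitrary: v rule: rev_induct)
  case Nil
  then have "v = []" by (cases v) auto
  then show ?case by (simp add: presentation_cong.refl)
next
  case (snoc x u)
  from snoc.prems have "v \<noteq> []" by (auto simp: relabel_snoc)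
  then obtain v' y where v: "v = v' @ [y]" by (metis rev_exhaust)
  with snoc.prems have eq: "relabel X u = relabel X v'"
    and last: "merge X (state u) x = merge X (state v') y"
    by (simp_all add: relabel_snoc)
  have "state u = state v'" using eq by (metis state_relabel)
  then have "(u @ [x], u @ [y]) \<in> presentation_cong (M_rels X)"
    using last by (auto intro: cong_if_merge_eq)
  moreover have "(u @ [y], v' @ [y]) \<in> presentation_cong (M_rels X)"
    using snoc.IH[OF eq] by (intro presentation_cong.append presentation_cong.refl)
  ultimately show ?case
    unfolding v by (rule presentation_cong.trans)
qed

abbreviation cls :: "nat set \<Rightarrow> letter list \<Rightarrow> letter list set" where
  "cls X w \<equiv> presentation_cong (M_rels X) `` {w}"

lemma cls_eq_iff: "cls X u = cls X v \<longleftrightarrow> relabel X u = relabel X v"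
  using cong_if_relabel_eq relabel_from_cong
  by (metis UNIV_I eq_equiv_class_iff equiv_presentation_cong)

lemma pverts_M_graph: "pverts (M_graph X) = range (cls X)"
  by (auto simp: M_graph_def right_cayley_graph_def M_monoid_def presented_monoid_def quotient_def)

text \<open>Multiplying by a generator appends a letter, and relabelling turns this into appending
  one relabelled letter.\<close>

lemma parcs_M_graph_iff:
  "(cls X u, cls X v) \<in> parcs (M_graph X) \<longleftrightarrow> (\<exists>x. relabel X v = relabel X u @ [x])"
proof -
  have "(cls X u, cls X v) \<in> parcs (M_graph X) \<longleftrightarrow> (\<exists>y. cls X (u @ [y]) = cls X v)"
    using pverts_M_graph[of X]
    by (auto simp: M_graph_def right_cayley_graph_def presented_gens_def M_monoid_def
        presented_mult_class)
  also have "\<dots> \<longleftrightarrow> (\<exists>y. relabel X v = relabel X (u @ [y]))"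
    unfolding cls_eq_iff by metis
  also have "\<dots> \<longleftrightarrow> (\<exists>x. relabel X v = relabel X u @ [x])"
  proof
    assume "\<exists>x. relabel X v = relabel X u @ [x]"
    then obtain x where x: "relabel X v = relabel X u @ [x]" ..
    then have "v \<noteq> []" by auto
    \<comment> \<open>The generator is the last letter \<open>y\<close> of \<open>v\<close>. The
      letter \<open>x\<close> may fail: for an index outside \<open>X\<close>, \<open>Ld\<close>
      becomes \<open>Le\<close> while \<open>Le\<close> becomes \<open>Lc\<close>.\<close>
    then obtain v' y where v: "v = v' @ [y]" by (metis rev_exhaust)
    then have "relabel X v' = relabel X u" using x by (simp add: relabel_snoc)
    moreover from this have "state v' = state u" by (metis state_relabel)
    ultimately show "\<exists>y. relabel X v = relabel X (u @ [y])" by (auto simp: v relabel_snoc)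
  qed (auto simp: relabel_snoc)
  finally show ?thesis .
qed

section \<open>The prefix tree\<close>

text \<open>Words are numbered because the tree in the theorem has vertices of type
  \<open>nat\<close>; only injectivity matters.\<close>

definition code :: "letter list \<Rightarrow> nat" where
  "code = to_nat_on UNIV"

lemma inj_code: "inj code"
proof -
  have "countable (lists (UNIV :: letter set))"
    by (intro countable_lists countable_finite) (simp add: UNIV_letter)
  then show ?thesis by (auto simp: code_def intro: inj_on_to_nat_on)
qed

definition word_tree :: "nat pair_pre_digraph" where
  "word_tree = \<lparr> pverts = code ` tree_words,
    parcs = {(code w, code (w @ [x])) | w x. w @ [x] \<in> tree_words} \<rparr>"

lemma pverts_word_tree: "pverts word_tree = code ` tree_words"
  by (simp add: word_tree_def)

lemma parcs_word_tree_iff: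
  "(code u, code v) \<in> parcs word_tree \<longleftrightarrow> v \<in> tree_words \<and> (\<exists>x. v = u @ [x])"
  by (auto simp: word_tree_def inj_eq[OF inj_code])

lemma parcs_word_treeE:
  assumes "e \<in> parcs word_tree"
  obtains w x where "e = (code w, code (w @ [x]))" "w @ [x] \<in> tree_words"
  using assms by (auto simp: word_tree_def)

lemma pair_wf_digraph_word_tree: "pair_wf_digraph word_tree"
  by unfold_locales (auto simp: word_tree_def snoc_in_tree_words)

lemma directed_rooted_tree_word_tree: "directed_rooted_tree word_tree (code [])"
\<comment> \<open>The height of a vertex is the length of the word it encodes.\<close>
proof (rule directed_rooted_treeI[where h = "\<lambda>n. length (inv_into UNIV code n)"])
  note [simp] = inv_f_f[OF inj_code] inj_eq[OF inj_code]
  show "code [] \<in> pverts word_tree"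
    by (simp add: pverts_word_tree Nil_in_tree_words)
  show "length (inv_into UNIV code (code [])) = 0"
    by simp
  show "length (inv_into UNIV code v) = Suc (length (inv_into UNIV code u))"
    if "(u, v) \<in> parcs word_tree" for u v
    using that by (auto elim!: parcs_word_treeE)
  show "u = u'" if "(u, v) \<in> parcs word_tree" "(u', v) \<in> parcs word_tree" for u u' v
    using that by (auto elim!: parcs_word_treeE)
  show "\<exists>u. (u, v) \<in> parcs word_tree" if v: "v \<in> pverts word_tree" "v \<noteq> code []" for v
  proof -
    obtain w where w: "v = code w" "w \<in> tree_words" "w \<noteq> []"
      using v by (auto simp: pverts_word_tree)
    then have "(code (butlast w), v) \<in> parcs word_tree"
      by (auto simp: parcs_word_tree_iff intro!: exI[of _ "last w"])
    then show ?thesis ..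
  qed
qed (rule pair_wf_digraph_word_tree)

text \<open>Children of a word correspond to its allowed next letters: five in state
  \<open>None\<close>, four otherwise.\<close>

lemma out_degree_word_tree:
  assumes "v \<in> pverts word_tree"
  shows "out_degree (with_proj word_tree) v = 4 \<or> out_degree (with_proj word_tree) v = 5"
proof -
  obtain w where w: "v = code w" "w \<in> tree_words"
    using assms by (auto simp: pverts_word_tree)
  note [simp] = inj_eq[OF inj_code]
  have "out_arcs (with_proj word_tree) v = (\<lambda>x. (code w, code (w @ [x]))) ` allowed (state w)"
    using w by (auto simp: out_arcs_def snoc_in_tree_words parcs_word_tree_iff
        elim!: parcs_word_treeE)
  moreover have "inj_on (\<lambda>x. (code w, code (w @ [x]))) (allowed (state w))"
    by (rule inj_onI) simp
  ultimately have "out_degree (with_proj word_tree) v = card (allowed (state w))"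
    by (simp add: out_degree_def card_image)
  then show ?thesis by (simp add: allowed_def UNIV_letter)
qed

text \<open>\<open>relabel X\<close> is constant on each class \<open>P\<close>, so \<open>SOME\<close> picks an immaterial representative.\<close>

lemma graph_iso_M_graph_word_tree:
  "graph_iso (M_graph X) word_tree (\<lambda>P. code (relabel X (SOME u. u \<in> P)))"
  (is "graph_iso _ _ ?f")
proof -
  have f: "?f (cls X u) = code (relabel X u)" for u
  proof -
    have "(SOME v. v \<in> cls X u) \<in> cls X u"
      by (rule someI[of _ u]) (simp add: presentation_cong.refl)
    then have "(u, SOME v. v \<in> cls X u) \<in> presentation_cong (M_rels X)" by simp
    then show ?thesis using relabel_from_cong by metis
  qed
  have "inj_on ?f (range (cls X))"
  proof (rule inj_onI)
    fix P Q assume "P \<in> range (cls X)" "Q \<in> range (cls X)" "?f P = ?f Q"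
    then obtain u v where uv: "P = cls X u" "Q = cls X v" "?f (cls X u) = ?f (cls X v)"
      by blast
    then show "P = Q"
      unfolding f by (metis cls_eq_iff injD[OF inj_code])
  qed
  moreover have "?f ` range (cls X) = code ` tree_words"
    unfolding image_image f range_relabel[of X, symmetric] ..
  moreover have "(cls X u, cls X v) \<in> parcs (M_graph X) \<longleftrightarrow>
      (?f (cls X u), ?f (cls X v)) \<in> parcs word_tree" for u v
    unfolding f parcs_M_graph_iff parcs_word_tree_iff using range_relabel by blast
  ultimately show ?thesis
    by (auto simp: graph_iso_def bij_betw_def pverts_M_graph pverts_word_tree)
qed

theorem proposition4p6:
  fixes X Y :: "nat set"
  shows "isometric (M_graph X) (M_graph Y) \<and>
    (\<exists>(T :: nat pair_pre_digraph) r.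
      directed_rooted_tree T r \<and>
      (\<forall>v\<in>pverts T. out_degree T v = 4 \<or> out_degree T v = 5) \<and>
      isometric (M_graph X) T \<and> isometric (M_graph Y) T)"
proof -
  have wf: "pair_wf_digraph (M_graph Z)" for Z
    by (simp add: M_graph_def pair_wf_digraph_right_cayley_graph)
  have "isometric (M_graph Z) word_tree" for Z
    using wf pair_wf_digraph_word_tree graph_iso_M_graph_word_tree
    by (rule isometric_if_graph_iso)
  \<comment> \<open>The word tree is the same for \<open>X\<close> and \<open>Y\<close>, so one
    isomorphism is composed with the inverse of the other.\<close>
  moreover have "isometric (M_graph X) (M_graph Y)"
    using wf wf graph_iso_comp[OF graph_iso_M_graph_word_tree
        graph_iso_inv[OF graph_iso_M_graph_word_tree]]
    by (rule isometric_if_graph_iso)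
  ultimately show ?thesis
    using directed_rooted_tree_word_tree out_degree_word_tree by blast
qed

end
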